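(* For integers $1\le k\le N-1$, say that $(N,k)$ is optimal if $S_N(12\cdots k)>B^c_N(12\cdots k)$ (as rational numbers). Then: (i) if $(N,k)$ is optimal then $(N+1,k+1)$ is optimal; (ii) if $(N,k)$ is not optimal then $(N+1,k)$ is not optimal.
   Context: $\mathrm{Av}_N(321)$ is the set of permutations $\pi=\pi_1\cdots\pi_N$ of $[N]$ with no indices $a<b<c$ such that $\pi_a>\pi_b>\pi_c$. The $i$th prefix flattening $\pi|_{[i]}$ is the permutation of $[i]$ in the same relative order as $\pi_1,\dots,\pi_i$. $S_N(12\cdots k)$ is the probability that $\pi_k=N$ for $\pi$ uniformly random among $\pi\in\mathrm{Av}_N(321)$ with $\pi|_{[k]}=12\cdots k$. $B^c_N(12\cdots k)$ is the maximal winning probability in the following restricted game: $\pi$ is chosen uniformly at random among $\pi\in\mathrm{Av}_N(321)$ with $\pi|_{[k]}=12\cdots k$; candidates $1,\dots,k$ are rejected; for $i=k+1,\dots,N$ the player is shown $\pi|_{[i]}$ and, using only the prefix flattenings seen so far, accepts candidate $i$ (ending the game) or rejects it, candidate $N$ being accepted if all earlier ones are rejected; the player wins iff the accepted candidate $i$ has $\pi_i=N$. *)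

theory Defs
  imports "HOL-Probability.Probability" "HOL-Combinatorics.Combinatorics"
begin

(* Permutations pi_1 ... pi_N of [N] are lists in one-line notation. List positions
   start at 0, so pi_i is p ! (i - 1). *)

definition contains_321 :: "nat list \<Rightarrow> bool" where
  "contains_321 p \<longleftrightarrow>
     (\<exists>a b c. a < b \<and> b < c \<and> c < length p \<and> p ! a > p ! b \<and> p ! b > p ! c)"

definition Av321 :: "nat \<Rightarrow> nat list set" where
  "Av321 N = {p \<in> permutations_of_set {1..N}. \<not> contains_321 p}"

(* Each entry is replaced by its rank among the entries of the list. *)
definition flatten :: "nat list \<Rightarrow> nat list" where
  "flatten xs = map (\<lambda>x. card {y \<in> set xs. y \<le> x}) xs"

definition prefix_flattening :: "nat list \<Rightarrow> nat \<Rightarrow> nat list" where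
  "prefix_flattening p i = flatten (take i p)"

definition Av321_id :: "nat \<Rightarrow> nat \<Rightarrow> nat list set" where
  "Av321_id N k = {p \<in> Av321 N. prefix_flattening p k = [1..<k + 1]}"

definition S_prob :: "nat \<Rightarrow> nat \<Rightarrow> real" where
  "S_prob N k = measure_pmf.prob (pmf_of_set (Av321_id N k)) {p. p ! (k - 1) = N}"

(* The player's information when deciding about candidate i. *)
definition history :: "nat list \<Rightarrow> nat \<Rightarrow> nat list list" where
  "history p i = map (prefix_flattening p) [1..<i + 1]"

(* A strategy maps each possible history to the decision "accept" (True) or "reject" (False). *)
type_synonym strategy = "nat list list \<Rightarrow> bool"

(* The index of the accepted candidate when candidates 1, ..., k are rejected outright;
   meaningful for k < N, where the disjunct i = N makes the LEAST well defined. *)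
definition accepted :: "nat \<Rightarrow> nat \<Rightarrow> strategy \<Rightarrow> nat list \<Rightarrow> nat" where
  "accepted N k \<sigma> p = (LEAST i. k < i \<and> (i = N \<or> \<sigma> (history p i)))"

definition win_prob :: "nat \<Rightarrow> nat \<Rightarrow> strategy \<Rightarrow> real" where
  "win_prob N k \<sigma> =
     measure_pmf.prob (pmf_of_set (Av321_id N k)) {p. p ! (accepted N k \<sigma> p - 1) = N}"

definition Bc_prob :: "nat \<Rightarrow> nat \<Rightarrow> real" where
  "Bc_prob N k = Max (range (win_prob N k))"

definition optimal :: "nat \<Rightarrow> nat \<Rightarrow> bool" where
  "optimal N k \<longleftrightarrow> S_prob N k > Bc_prob N k"

(* The next two facts show that the uniform distribution and the maximum above are well
   defined. *)
lemma Av321_id_finite_nonempty: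
  assumes "k \<le> N"
  shows "finite (Av321_id N k)" "Av321_id N k \<noteq> {}"
proof -
  have "Av321_id N k \<subseteq> permutations_of_set {1..N}"
    by (auto simp: Av321_id_def Av321_def)
  then show "finite (Av321_id N k)"
    by (rule finite_subset) simp
  have "card {y. Suc 0 \<le> y \<and> y < Suc k \<and> y \<le> x} = x" if "1 \<le> x" "x \<le> k" for x :: nat
  proof -
    have "{y. Suc 0 \<le> y \<and> y < Suc k \<and> y \<le> x} = {1..x}" using that by auto
    then show ?thesis by simp
  qed
  then have "prefix_flattening [1..<N + 1] k = [1..<k + 1]"
    using assms by (auto simp: prefix_flattening_def flatten_def take_upt intro!: map_idI
        simp del: upt_Suc)
  moreover have "\<not> contains_321 [1..<N + 1]"
    by (auto simp: contains_321_def simp del: upt_Suc)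
  moreover have "[1..<N + 1] \<in> permutations_of_set {1..N}"
    by (auto simp: permutations_of_set_def simp del: upt_Suc)
  ultimately have "[1..<N + 1] \<in> Av321_id N k"
    by (simp add: Av321_id_def Av321_def)
  then show "Av321_id N k \<noteq> {}" by blast
qed

lemma finite_range_win_prob:
  assumes "k \<le> N"
  shows "finite (range (win_prob N k))"
proof -
  let ?A = "Av321_id N k"
  have "win_prob N k \<sigma> \<in> (\<lambda>B. real (card B) / real (card ?A)) ` Pow ?A" for \<sigma>
    using Av321_id_finite_nonempty[OF assms]
    by (auto simp: win_prob_def measure_pmf_of_set)
  then have "range (win_prob N k) \<subseteq> (\<lambda>B. real (card B) / real (card ?A)) ` Pow ?A"
    by blast
  then show ?thesis
    using Av321_id_finite_nonempty(1)[OF assms] by (meson finite_Pow_iff finite_imageI finite_subset)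
qed

end

theory Submission
  imports Defs
begin

text \<open>The prefix seen so far influences the game only through two numbers: the number \<open>r\<close> of
  candidates still to come, and the number \<open>j\<close> of entries above the largest bottom of an inversion.
  Entries below that bottom can no longer take part in a 321-pattern, and the entries above it are
  increasing. The next candidate either becomes the new maximum, leading to \<open>(r - 1, j + 1)\<close>, or
  creates a new inversion bottom, leading to \<open>(r - 1, q)\<close> with \<open>1 \<le> q \<le> j\<close>, each \<open>q\<close>
  exactly once. Let \<open>wins r j\<close> count the completions won by accepting the current maximum, and
  \<open>val r j\<close> those won by the best play after rejecting it. Since the numbers \<open>wins (r - 1) q\<close>
  with \<open>1 \<le> q \<le> j\<close> add up to \<open>wins r j\<close>, the ratio \<open>val r j / wins r j\<close> is a decreasing term
  in \<open>j\<close> plus a weighted average of the ratios at \<open>(r - 1, q)\<close>. By induction on \<open>r\<close> it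
  decreases in \<open>j\<close>, and the average then shows that it increases in \<open>r\<close>. Optimality says that
  the ratio is below 1, and \<open>r = N - k\<close>, \<open>j = k\<close> for the prefix \<open>12\<dots>k\<close>.\<close>

section \<open>Monotonicity of the value recursion\<close>

text \<open>The number of weakly decreasing sequences of length \<open>r\<close> in
  \<open>{1..j}\<close>, that is, of multisets of size \<open>r\<close>. Truncated subtraction gives
  the right boundary values \<open>wins 0 0 = 1\<close> and
  \<open>wins (Suc r) 0 = 0\<close>.\<close>

definition wins :: "nat \<Rightarrow> nat \<Rightarrow> nat" where
  "wins r j = (r + j - 1) choose r"

text \<open>Only a new maximum offers a real choice, hence the single \<open>max\<close>. As
  \<open>val 0 j = 0\<close>, that \<open>max\<close> also models the forced acceptance of the last
  candidate.\<close>

fun val :: "nat \<Rightarrow> nat \<Rightarrow> nat" where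
  "val 0 j = 0"
| "val (Suc r) j = max (wins r (Suc j)) (val r (Suc j)) + (\<Sum>q = 1..j. val r q)"

lemma wins_pos: "1 \<le> j \<Longrightarrow> 0 < wins r j"
  by (simp add: wins_def)

text \<open>Hockey-stick identity, by Pascal's rule. It turns the counts \<open>wins r q\<close>
  into the weights of an average.\<close>

lemma sum_wins: "(\<Sum>q = 1..j. wins r q) = wins (Suc r) j"
proof (induction j)
  case (Suc j)
  then show ?case
    by (cases j) (simp_all add: wins_def add.commute)
qed (simp add: wins_def)

lemma wins_absorb: "j * wins r (Suc j) = Suc r * wins (Suc r) j"
proof (cases j)
  case (Suc i)
  have "Suc r * (Suc (r + i) choose Suc r) = Suc i * (Suc (r + i) choose r)"
    using binomial_absorb_comp[of "Suc (r + i)" r] Suc_times_binomial_eq[of "r + i" r]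
    by (simp add: Suc_diff_le)
  then show ?thesis using Suc by (simp add: wins_def)
qed (simp add: wins_def)

definition ratio :: "nat \<Rightarrow> nat \<Rightarrow> real" where
  "ratio r j = real (val r j) / real (wins r j)"

lemma val_eq_ratio: "1 \<le> j \<Longrightarrow> real (val r j) = ratio r j * wins r j"
  using wins_pos[of j r] by (simp add: ratio_def)

text \<open>The recursion for \<open>val\<close> divided by \<open>wins (Suc r) j\<close>: binomial
  absorption produces the factor \<open>Suc r / j\<close>, and by \<open>sum_wins\<close> the last
  summand is a weighted average of the ratios.\<close>

lemma ratio_Suc:
  assumes "1 \<le> j"
  shows "ratio (Suc r) j = real (Suc r) / real j * max 1 (ratio r (Suc j))
    + (\<Sum>q = 1..j. ratio r q * wins r q) / wins (Suc r) j"
proof -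
  have pos: "0 < real (wins r (Suc j))" "0 < real (wins (Suc r) j)"
    using wins_pos assms by simp_all
  have "real (wins r (Suc j)) / wins (Suc r) j = real (Suc r) / j"
    using wins_absorb[of j r] pos assms
    by (simp add: field_simps del: of_nat_Suc of_nat_add flip: of_nat_mult)
  moreover have "real (max (wins r (Suc j)) (val r (Suc j)))
      = max 1 (ratio r (Suc j)) * wins r (Suc j)"
    using pos by (simp add: val_eq_ratio max_mult_distrib_right of_nat_max)
  ultimately have "real (max (wins r (Suc j)) (val r (Suc j))) / wins (Suc r) j
      = real (Suc r) / j * max 1 (ratio r (Suc j))"
    by (metis mult.commute times_divide_eq_right)
  moreover have "(\<Sum>q = 1..j. real (val r q)) = (\<Sum>q = 1..j. ratio r q * wins r q)"
    by (intro sum.cong) (auto simp: val_eq_ratio)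
  ultimately show ?thesis
    by (simp add: ratio_def[of "Suc r"] add_divide_distrib del: of_nat_Suc)
qed

lemma ratio_le_average:
  assumes "1 \<le> j" and "\<And>q. q \<in> {1..j} \<Longrightarrow> c \<le> ratio r q"
  shows "c \<le> (\<Sum>q = 1..j. ratio r q * wins r q) / wins (Suc r) j"
proof -
  have "c * wins (Suc r) j = (\<Sum>q = 1..j. c * real (wins r q))"
    by (simp flip: sum_wins sum_distrib_left)
  also have "\<dots> \<le> (\<Sum>q = 1..j. ratio r q * wins r q)"
    by (intro sum_mono mult_right_mono assms(2)) auto
  finally show ?thesis
    using wins_pos[OF assms(1), of "Suc r"] by (simp add: pos_le_divide_eq)
qed

text \<open>Both summands of \<open>ratio_Suc\<close> decrease in \<open>j\<close>: the first
  through \<open>1 / j\<close> and the induction hypothesis, the average because each new term is at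
  most all earlier ones.\<close>

lemma ratio_antimono_Suc: "1 \<le> j \<Longrightarrow> ratio r (Suc j) \<le> ratio r j"
proof (induction r arbitrary: j)
  case 0
  then show ?case by (simp add: ratio_def)
next
  case (Suc r)
  let ?A = "\<lambda>j. (\<Sum>q = 1..j. ratio r q * wins r q)"
  have anti: "ratio r b \<le> ratio r a" if "1 \<le> a" "a \<le> b" for a b
    using that(2)
  proof (induction rule: dec_induct)
    case (step n)
    then show ?case using Suc.IH[of n] that(1) by simp
  qed simp
  have nonneg: "0 < real (wins (Suc r) j)" "0 < real (wins (Suc r) (Suc j))"
    using wins_pos Suc.prems by simp_all
  \<comment> \<open>The term that joins the average at \<open>Suc j\<close> is at most the old
    average, so the average cannot rise.\<close>
  have "ratio r (Suc j) \<le> ?A j / wins (Suc r) j"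
    using Suc.prems by (intro ratio_le_average anti) auto
  then have "ratio r (Suc j) * wins r (Suc j) \<le> ?A j / wins (Suc r) j * wins r (Suc j)"
    by (rule mult_right_mono) simp
  moreover have w: "real (wins (Suc r) (Suc j)) = wins (Suc r) j + wins r (Suc j)"
    by (simp flip: sum_wins)
  ultimately have "?A (Suc j) \<le> ?A j / wins (Suc r) j * wins (Suc r) (Suc j)"
    using nonneg by (simp add: distrib_left)
  then have "?A (Suc j) / wins (Suc r) (Suc j) \<le> ?A j / wins (Suc r) j"
    using nonneg by (simp add: pos_divide_le_eq)
  moreover have "real (Suc r) / real (Suc j) * max 1 (ratio r (Suc (Suc j)))
      \<le> real (Suc r) / real j * max 1 (ratio r (Suc j))"
    using Suc.prems Suc.IH[of "Suc j"] by (intro mult_mono divide_left_mono max.mono) auto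
  ultimately show ?case
    using Suc.prems by (subst (1 2) ratio_Suc) auto
qed

lemma ratio_antimono:
  assumes "1 \<le> a" and "a \<le> b"
  shows "ratio r b \<le> ratio r a"
  using assms(2)
proof (induction rule: dec_induct)
  case (step n)
  then show ?case using ratio_antimono_Suc[of n r] assms(1) by simp
qed simp

text \<open>The average in \<open>ratio_Suc\<close> runs over \<open>q \<le> j\<close> only, where
  every ratio is at least \<open>ratio r j\<close>.\<close>

lemma ratio_Suc_ge:
  assumes "1 \<le> j"
  shows "ratio r j \<le> ratio (Suc r) j"
proof -
  have "0 \<le> real (Suc r) / real j * max 1 (ratio r (Suc j))"
    by simp
  moreover have "ratio r j \<le> (\<Sum>q = 1..j. ratio r q * wins r q) / wins (Suc r) j"
    using assms by (intro ratio_le_average ratio_antimono) auto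
  ultimately show ?thesis
    using ratio_Suc[OF assms, of r] by linarith
qed

lemma val_less_wins_iff: "1 \<le> j \<Longrightarrow> val r j < wins r j \<longleftrightarrow> ratio r j < 1"
  using wins_pos[of j r] by (simp add: ratio_def)

section \<open>Flattenings and one-point extensions\<close>

lemma flatten_map:
  assumes "strict_mono_on (set xs) f"
  shows "flatten (map f xs) = flatten xs"
proof -
  have "card {y \<in> f ` set xs. y \<le> f x} = card {y \<in> set xs. y \<le> x}" if "x \<in> set xs" for x
  proof -
    have "{y \<in> f ` set xs. y \<le> f x} = f ` {y \<in> set xs. y \<le> x}"
      using strict_mono_on_less_eq[OF assms] that by auto
    moreover have "inj_on f {y \<in> set xs. y \<le> x}"
      using strict_mono_on_imp_inj_on[OF assms] by (rule inj_on_subset) auto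
    ultimately show ?thesis by (simp add: card_image)
  qed
  then show ?thesis by (simp add: flatten_def)
qed

lemma contains_321_map:
  assumes "strict_mono_on (set xs) f"
  shows "contains_321 (map f xs) \<longleftrightarrow> contains_321 xs"
proof -
  have "f (xs ! a) < f (xs ! b) \<longleftrightarrow> xs ! a < xs ! b" if "a < length xs" "b < length xs" for a b
    using strict_mono_on_less[OF assms] that by simp
  then show ?thesis
    unfolding contains_321_def by (simp cong: conj_cong)
qed

text \<open>Flattening is thus itself an increasing relabelling, to which \<open>flatten_map\<close>
  and \<open>contains_321_map\<close> apply.\<close>

lemma strict_mono_on_rank: "strict_mono_on (set xs) (\<lambda>x. card {y \<in> set xs. y \<le> (x :: nat)})"
  by (rule strict_mono_onI) (rule psubset_card_mono; force)

lemma length_flatten [simp]: "length (flatten xs) = length xs"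
  by (simp add: flatten_def)

lemma flatten_take_flatten: "flatten (take l (flatten xs)) = flatten (take l xs)"
proof -
  have "strict_mono_on (set (take l xs)) (\<lambda>x. card {y \<in> set xs. y \<le> x})"
    using strict_mono_on_rank set_take_subset by (rule monotone_on_subset)
  then show ?thesis
    by (simp add: flatten_def[of xs] take_map flatten_map)
qed

lemma contains_321_flatten: "contains_321 (flatten xs) \<longleftrightarrow> contains_321 xs"
  unfolding flatten_def by (rule contains_321_map[OF strict_mono_on_rank])

lemma contains_321_take: "contains_321 (take l p) \<Longrightarrow> contains_321 p"
  unfolding contains_321_def by (elim exE, intro exI) auto

lemma flatten_permutation:
  assumes "p \<in> permutations_of_set {1..n}"
  shows "flatten p = p"
proof -
  have "{y. Suc 0 \<le> y \<and> y \<le> n \<and> y \<le> x} = {1..x}" if "x \<le> n" for x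
    using that by auto
  then show ?thesis
    using permutations_of_setD[OF assms] by (auto simp: flatten_def intro!: map_idI)
qed

text \<open>A child of \<open>t\<close> in the tree of prefix flattenings: the new candidate has
  rank \<open>v\<close>, and entries from \<open>v\<close> upwards make room for it.\<close>

definition ext :: "nat list \<Rightarrow> nat \<Rightarrow> nat list" where
  "ext t v = map (\<lambda>x. if v \<le> x then Suc x else x) t @ [v]"

lemma length_ext [simp]: "length (ext t v) = Suc (length t)"
  by (simp add: ext_def)

lemma ext_last [simp]: "ext t v ! length t = v" "last (ext t v) = v"
  by (simp_all add: ext_def nth_append)

lemma ext_nth: "a < length t \<Longrightarrow> ext t v ! a = (if v \<le> t ! a then Suc (t ! a) else t ! a)"
  by (simp add: ext_def nth_append)

lemma flatten_take_ext: "flatten (take (length t) (ext t v)) = flatten t"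
  by (simp add: ext_def flatten_map strict_mono_on_def)

lemma flatten_snoc:
  assumes "x \<notin> set xs"
  shows "flatten (xs @ [x]) = ext (flatten xs) (Suc (card {y \<in> set xs. y < x}))"
proof -
  have "card {y. (y = x \<or> y \<in> set xs) \<and> y \<le> z} =
      (if Suc (card {y \<in> set xs. y < x}) \<le> card {y \<in> set xs. y \<le> z}
       then Suc (card {y \<in> set xs. y \<le> z}) else card {y \<in> set xs. y \<le> z})"
    if "z \<in> set xs" for z
  proof (cases "x < z")
    case True
    then have "{y. (y = x \<or> y \<in> set xs) \<and> y \<le> z} = insert x {y \<in> set xs. y \<le> z}"
      by auto
    \<comment> \<open>Strict because \<open>z\<close> is counted on the right only.\<close>
    moreover have "card {y \<in> set xs. y < x} < card {y \<in> set xs. y \<le> z}"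
      using True that by (intro psubset_card_mono psubsetI) (auto simp: set_eq_iff intro!: exI[of _ z])
    ultimately show ?thesis using assms by simp
  next
    case False
    then have "z < x" using assms that by (metis nat_neq_iff)
    then have "{y. (y = x \<or> y \<in> set xs) \<and> y \<le> z} = {y \<in> set xs. y \<le> z}"
      by auto
    moreover have "card {y \<in> set xs. y \<le> z} \<le> card {y \<in> set xs. y < x}"
      using \<open>z < x\<close> by (intro card_mono) auto
    ultimately show ?thesis by simp
  qed
  moreover have "{y. (y = x \<or> y \<in> set xs) \<and> y \<le> x} = insert x {y \<in> set xs. y < x}"
    using assms by auto
  ultimately show ?thesis
    by (simp add: flatten_def ext_def)
qed

lemma ext_permutation:
  assumes "t \<in> permutations_of_set {1..i}" and "v \<in> {1..Suc i}"
  shows "ext t v \<in> permutations_of_set {1..Suc i}"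
proof -
  let ?g = "\<lambda>x. if v \<le> x then Suc x else x"
  have t: "set t = {1..i}" "distinct t"
    using permutations_of_setD[OF assms(1)] by auto
  have "inj_on ?g (set t)"
    by (rule inj_onI) (simp split: if_splits)
  moreover have "v \<notin> ?g ` set t"
    by (simp add: image_iff)
  ultimately have "distinct (ext t v)"
    using t(2) by (simp add: ext_def distinct_map)
  moreover have "set (ext t v) = {1..Suc i}"
  proof (rule card_subset_eq)
    show "set (ext t v) \<subseteq> {1..Suc i}"
      using t assms(2) by (auto simp: ext_def)
    show "card (set (ext t v)) = card {1..Suc i}"
      using distinct_card[OF \<open>distinct (ext t v)\<close>] distinct_card[OF t(2)] t(1) by simp
  qed simp
  ultimately show ?thesis by (simp add: permutations_of_set_def)
qed

lemma flatten_in_permutations: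
  "distinct xs \<Longrightarrow> flatten xs \<in> permutations_of_set {1..length xs}"
proof (induction xs rule: rev_induct)
  case Nil
  then show ?case by (simp add: flatten_def)
next
  case (snoc x xs)
  have "card {y \<in> set xs. y < x} \<le> card (set xs)"
    by (intro card_mono) auto
  also have "\<dots> \<le> length xs" by (rule card_length)
  finally show ?case
    using snoc ext_permutation[of "flatten xs" "length xs"] by (simp add: flatten_snoc)
qed

section \<open>Inversion bottoms and 321-avoidance of extensions\<close>

definition inv_bottoms :: "nat list \<Rightarrow> nat set" where
  "inv_bottoms t = {t ! b |a b. a < b \<and> b < length t \<and> t ! b < t ! a}"

text \<open>The default 0 lets the admissible insertion values start at
  \<open>Suc (max_bottom t)\<close> even when \<open>t\<close> has no inversion.\<close>

definition max_bottom :: "nat list \<Rightarrow> nat" where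
  "max_bottom t = Max (insert 0 (inv_bottoms t))"

lemma finite_inv_bottoms: "finite (inv_bottoms t)"
  by (rule finite_subset[of _ "set t"]) (auto simp: inv_bottoms_def)

lemma max_bottom_less_iff: "max_bottom t < v \<longleftrightarrow> 0 < v \<and> (\<forall>x\<in>inv_bottoms t. x < v)"
  using finite_inv_bottoms by (simp add: max_bottom_def)

text \<open>In a new pattern the last entry is the smallest, below an inversion of \<open>t\<close>.
  The case \<open>v = x\<close> counts, since the extension raises \<open>x\<close> to
  \<open>Suc x\<close>.\<close>

lemma contains_321_ext:
  "contains_321 (ext t v) \<longleftrightarrow> contains_321 t \<or> (\<exists>x\<in>inv_bottoms t. v \<le> x)"
proof
  assume "contains_321 (ext t v)"
  then obtain a b c where abc: "a < b" "b < c" "c < Suc (length t)"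
      "ext t v ! a > ext t v ! b" "ext t v ! b > ext t v ! c"
    by (auto simp: contains_321_def)
  show "contains_321 t \<or> (\<exists>x\<in>inv_bottoms t. v \<le> x)"
  proof (cases "c = length t")
    case True
    then have "t ! b \<in> inv_bottoms t" "v \<le> t ! b"
      using abc by (auto simp: ext_nth inv_bottoms_def split: if_splits)
    then show ?thesis by blast
  next
    case False
    then have "t ! a > t ! b" "t ! b > t ! c" "c < length t"
      using abc by (auto simp: ext_nth split: if_splits)
    then show ?thesis using abc(1,2) unfolding contains_321_def by blast
  qed
next
  assume "contains_321 t \<or> (\<exists>x\<in>inv_bottoms t. v \<le> x)"
  then show "contains_321 (ext t v)"
  proof
    assume "contains_321 t"
    then obtain a b c where abc: "a < b" "b < c" "c < length t" "t ! a > t ! b" "t ! b > t ! c"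
      by (auto simp: contains_321_def)
    then show ?thesis unfolding contains_321_def
      by (intro exI[of _ a] exI[of _ b] exI[of _ c]) (auto simp: ext_nth)
  next
    assume "\<exists>x\<in>inv_bottoms t. v \<le> x"
    then obtain a b where "a < b" "b < length t" "t ! b < t ! a" "v \<le> t ! b"
      by (auto simp: inv_bottoms_def)
    then show ?thesis unfolding contains_321_def
      by (intro exI[of _ a] exI[of _ b] exI[of _ "length t"]) (auto simp: ext_nth)
  qed
qed

lemma Av321_length: "t \<in> Av321 i \<Longrightarrow> length t = i"
  by (auto simp: Av321_def dest: length_finite_permutations_of_set)

lemma Av321_flatten: "t \<in> Av321 i \<Longrightarrow> flatten t = t"
  by (auto simp: Av321_def intro: flatten_permutation)

lemma ext_in_Av321_iff:
  assumes "t \<in> Av321 i" and "v \<in> {1..Suc i}"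
  shows "ext t v \<in> Av321 (Suc i) \<longleftrightarrow> max_bottom t < v"
  using assms ext_permutation[of t i v]
  by (auto simp: Av321_def contains_321_ext max_bottom_less_iff not_le not_less)

text \<open>Old bottoms lie below \<open>v\<close> and are not shifted; the new entry is a bottom
  exactly when some entry ends up above it.\<close>

lemma inv_bottoms_ext:
  assumes "t \<in> Av321 i" and "v \<in> {Suc (max_bottom t)..Suc i}"
  shows "inv_bottoms (ext t v) = inv_bottoms t \<union> (if v \<le> i then {v} else {})"
proof (intro equalityI subsetI)
  note len = Av321_length[OF assms(1)]
  have set_t: "set t = {1..i}"
    using assms(1) by (auto simp: Av321_def dest: permutations_of_setD)
  have low: "x < v" if "x \<in> inv_bottoms t" for x
    using assms(2) that max_bottom_less_iff[of t v] by auto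
  fix x
  {
    assume "x \<in> inv_bottoms (ext t v)"
    then obtain a b where ab: "a < b" "b < Suc i" "ext t v ! b < ext t v ! a" "x = ext t v ! b"
      by (auto simp: inv_bottoms_def len)
    show "x \<in> inv_bottoms t \<union> (if v \<le> i then {v} else {})"
    proof (cases "b = i")
      case True
      then have "v \<le> t ! a" "x = v" "a < length t"
        using ab len ext_last(1)[of t v] by (auto simp: ext_nth split: if_splits)
      then have "v \<le> i" using set_t nth_mem[of a t] by auto
      then show ?thesis using \<open>x = v\<close> by simp
    next
      case False
      then have "t ! b < t ! a" "b < length t"
        using ab len by (auto simp: ext_nth split: if_splits)
      then have "t ! b \<in> inv_bottoms t" using ab by (auto simp: inv_bottoms_def)
      then show ?thesis using low[of "t ! b"] ab \<open>b < length t\<close> by (auto simp: ext_nth)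
    qed
  }
  {
    assume "x \<in> inv_bottoms t \<union> (if v \<le> i then {v} else {})"
    then consider "x \<in> inv_bottoms t" | "x = v" "v \<le> i"
      by (auto split: if_splits)
    then show "x \<in> inv_bottoms (ext t v)"
    proof cases
      case 1
      then obtain a b where ab: "a < b" "b < length t" "t ! b < t ! a" "x = t ! b"
        by (auto simp: inv_bottoms_def)
      then show ?thesis using low[OF 1] unfolding inv_bottoms_def
        by (intro CollectI exI[of _ a] exI[of _ b]) (auto simp: ext_nth)
    next
      case 2
      \<comment> \<open>The old entry \<open>v\<close> is raised to \<open>Suc v\<close> and forms
        an inversion with the new last entry.\<close>
      then have "v \<in> set t" using set_t assms(2) by auto
      then obtain a where "a < length t" "t ! a = v" by (auto simp: in_set_conv_nth)
      then show ?thesis using 2 unfolding inv_bottoms_def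
        by (intro CollectI exI[of _ a] exI[of _ "length t"]) (auto simp: ext_nth)
    qed
  }
qed

text \<open>The state transition: with \<open>j = i - max_bottom t\<close>, insertion at
  \<open>Suc i\<close> leads to \<open>Suc j\<close>, and insertion at \<open>v \<le> i\<close>
  leads to \<open>Suc i - v\<close>, which takes each value in \<open>{1..j}\<close> once.\<close>

lemma max_bottom_ext:
  assumes "t \<in> Av321 i" and "v \<in> {Suc (max_bottom t)..Suc i}"
  shows "max_bottom (ext t v) = (if v \<le> i then v else max_bottom t)"
proof (cases "v \<le> i")
  case True
  then show ?thesis
    using assms(2) inv_bottoms_ext[OF assms] max_bottom_less_iff[of t v] finite_inv_bottoms[of t]
    by (auto simp: max_bottom_def[of "ext t v"] intro!: Max_eqI)
qed (simp add: inv_bottoms_ext[OF assms] max_bottom_def)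

lemma max_bottom_le:
  assumes "t \<in> Av321 i"
  shows "max_bottom t \<le> i"
proof -
  have "inv_bottoms t \<subseteq> set t"
    by (auto simp: inv_bottoms_def)
  also have "set t = {1..i}"
    using assms by (auto simp: Av321_def dest: permutations_of_setD)
  finally show ?thesis
    using finite_inv_bottoms by (auto simp: max_bottom_def)
qed

section \<open>Completions of a prefix\<close>

definition completions :: "nat \<Rightarrow> nat list \<Rightarrow> nat list set" where
  "completions N t = {p \<in> Av321 N. flatten (take (length t) p) = t}"

lemma finite_completions: "finite (completions N t)"
  by (rule finite_subset[of _ "permutations_of_set {1..N}"]) (auto simp: completions_def Av321_def)

lemma completions_self: "t \<in> Av321 N \<Longrightarrow> completions N t = {t}"
  by (auto simp: completions_def Av321_length Av321_flatten)

text \<open>A completion belongs to the branch given by the flattening of its first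
  \<open>Suc i\<close> entries, which again avoids 321.\<close>

lemma completions_eq_Un:
  assumes "t \<in> Av321 i" and "i < N"
  shows "completions N t = (\<Union>v\<in>{Suc (max_bottom t)..Suc i}. completions N (ext t v))"
proof (intro equalityI subsetI)
  note len = Av321_length[OF assms(1)]
  fix p
  {
    assume p: "p \<in> completions N t"
    then have "p \<in> Av321 N" and t: "flatten (take i p) = t"
      by (auto simp: completions_def len)
    then have plen: "length p = N" and dist: "distinct p" and av: "\<not> contains_321 p"
      by (auto simp: Av321_length) (auto simp: Av321_def permutations_of_set_def)
    let ?v = "Suc (card {y \<in> set (take i p). y < p ! i})"
    have split: "take (Suc i) p = take i p @ [p ! i]"
      using assms(2) plen by (simp add: take_Suc_conv_app_nth)
    have "distinct (take (Suc i) p)" using dist by simp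
    then have flat: "flatten (take (Suc i) p) = ext t ?v"
      using t unfolding split by (subst flatten_snoc) auto
    have "card {y \<in> set (take i p). y < p ! i} \<le> card (set (take i p))"
      by (intro card_mono) auto
    also have "\<dots> \<le> i" using card_length[of "take i p"] by simp
    finally have v: "?v \<in> {1..Suc i}" by simp
    have "ext t ?v \<in> Av321 (Suc i)"
      using flatten_in_permutations[of "take (Suc i) p"] dist av plen assms(2)
        contains_321_take[of "Suc i" p] contains_321_flatten[of "take (Suc i) p"]
      by (auto simp: Av321_def simp flip: flat)
    then have "max_bottom t < ?v"
      using ext_in_Av321_iff[OF assms(1) v] by simp
    moreover have "p \<in> completions N (ext t ?v)"
      using \<open>p \<in> Av321 N\<close> flat by (simp add: completions_def len)
    ultimately show "p \<in> (\<Union>v\<in>{Suc (max_bottom t)..Suc i}. completions N (ext t v))"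
      using v by (intro UN_I[of ?v]) auto
  }
  {
    assume "p \<in> (\<Union>v\<in>{Suc (max_bottom t)..Suc i}. completions N (ext t v))"
    then obtain v where p: "p \<in> Av321 N" "flatten (take (Suc i) p) = ext t v"
      by (auto simp: completions_def len)
    \<comment> \<open>The flattening of the longer prefix determines that of the shorter
      one.\<close>
    have "flatten (take i p) = flatten (take i (flatten (take (Suc i) p)))"
      by (simp add: flatten_take_flatten min_def)
    also have "\<dots> = flatten t"
      using flatten_take_ext[of t v] by (simp add: p len)
    also have "\<dots> = t"
      by (rule Av321_flatten[OF assms(1)])
    finally show "p \<in> completions N t"
      using p by (simp add: completions_def len)
  }
qed

lemma completions_ext_disjoint:
  assumes "v \<noteq> w"
  shows "completions N (ext t v) \<inter> completions N (ext t w) = {}"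
proof -
  have "ext t v \<noteq> ext t w"
    using assms by (metis ext_last(2))
  then show ?thesis
    by (auto simp: completions_def)
qed

lemma card_completions_split:
  assumes "t \<in> Av321 i" and "i < N"
  shows "card {p \<in> completions N t. P p}
    = (\<Sum>v = Suc (max_bottom t)..Suc i. card {p \<in> completions N (ext t v). P p})"
proof -
  have "{p \<in> completions N t. P p}
      = (\<Union>v\<in>{Suc (max_bottom t)..Suc i}. {p \<in> completions N (ext t v). P p})"
    using completions_eq_Un[OF assms] by auto
  moreover have "disjoint_family_on (\<lambda>v. {p \<in> completions N (ext t v). P p}) A" for A
    using completions_ext_disjoint by (fastforce simp: disjoint_family_on_def)
  ultimately show ?thesis
    using finite_completions by (simp add: card_UN_disjoint')
qed

section \<open>Counting the completions won by a given candidate\<close>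

lemma nth_flatten_take_max:
  assumes "p \<in> Av321 N" and "a < i" and "i \<le> N" and "p ! a = N"
  shows "flatten (take i p) ! a = i"
proof -
  have p: "set p = {1..N}" "distinct p" "length p = N"
    using assms(1) Av321_length by (auto simp: Av321_def dest: permutations_of_setD)
  have "y \<le> N" if "y \<in> set (take i p)" for y
    using in_set_takeD[OF that] p(1) by simp
  then have "{y \<in> set (take i p). y \<le> p ! a} = set (take i p)"
    using assms(4) by auto
  moreover have "card (set (take i p)) = i"
    using distinct_card[of "take i p"] p assms(3) by simp
  ultimately show ?thesis
    using assms p(3) by (simp add: flatten_def)
qed

text \<open>The candidate at position \<open>a\<close> must stay the maximum, so every later candidate is inserted
  below the top; each such insertion at \<open>v\<close> leaves \<open>Suc i - v\<close> entries above the new largest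
  inversion bottom.\<close>

lemma card_completions_max:
  assumes "t \<in> Av321 i" and "i \<le> N" and "a < i" and "t ! a = i"
  shows "card {p \<in> completions N t. p ! a = N} = wins (N - i) (i - max_bottom t)"
  using assms
proof (induction "N - i" arbitrary: t i)
  case 0
  then have "i = N" by simp
  with 0 have "{p \<in> completions N t. p ! a = N} = {t}"
    by (auto simp: completions_self)
  then show ?case using \<open>i = N\<close> by (simp add: wins_def)
next
  case (Suc r)
  note len = Av321_length[OF Suc.prems(1)]
  have "i < N" using Suc.hyps(2) by simp
  let ?m = "max_bottom t"
  let ?f = "\<lambda>v. card {p \<in> completions N (ext t v). p ! a = N}"
  have m: "?m \<le> i" by (rule max_bottom_le[OF Suc.prems(1)])
  have top: "?f (Suc i) = 0"
  proof -
    have "ext t (Suc i) ! a = Suc i" if "p \<in> completions N (ext t (Suc i))" "p ! a = N" for p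
      using nth_flatten_take_max[of p N a "Suc i"] that Suc.prems(3) \<open>i < N\<close>
      by (simp add: completions_def len)
    moreover have "ext t (Suc i) ! a = i"
      using Suc.prems(3,4) len by (simp add: ext_nth)
    ultimately show ?thesis by (auto simp: card_eq_0_iff)
  qed
  have step: "?f v = wins r (Suc i - v)" if v: "v \<in> {Suc ?m..i}" for v
  proof -
    have "ext t v \<in> Av321 (Suc i)"
      using ext_in_Av321_iff[OF Suc.prems(1), of v] v by simp
    moreover have "ext t v ! a = Suc i"
      using Suc.prems(3,4) len v by (simp add: ext_nth)
    moreover have "max_bottom (ext t v) = v"
      using max_bottom_ext[OF Suc.prems(1), of v] v by simp
    moreover have "r = N - Suc i" using Suc.hyps(2) by simp
    ultimately show ?thesis
      using Suc.hyps(1)[of "Suc i" "ext t v"] \<open>i < N\<close> Suc.prems(3) by simp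
  qed
  have "card {p \<in> completions N t. p ! a = N} = (\<Sum>v = Suc ?m..Suc i. ?f v)"
    by (rule card_completions_split[OF Suc.prems(1) \<open>i < N\<close>])
  also have "\<dots> = (\<Sum>v = Suc ?m..i. ?f v)"
    using m top by simp
  also have "\<dots> = (\<Sum>v = Suc ?m..i. wins r (Suc i - v))"
    using step by (rule sum.cong[OF refl])
  also have "\<dots> = (\<Sum>q = 1..i - ?m. wins r q)"
    by (rule sum.reindex_bij_witness[of _ "\<lambda>q. Suc i - q" "\<lambda>v. Suc i - v"]) (use m in auto)
  finally show ?case
    unfolding sum_wins Suc.hyps(2) .
qed

text \<open>The entry \<open>N\<close> has top rank in every prefix that contains it.\<close>

lemma card_completions_not_max:
  assumes "t \<in> Av321 i" and "i \<le> N" and "a < i" and "t ! a \<noteq> i"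
  shows "card {p \<in> completions N t. p ! a = N} = 0"
proof -
  have "p ! a \<noteq> N" if "p \<in> completions N t" for p
    using nth_flatten_take_max[of p N a i] that assms Av321_length[OF assms(1)]
    by (auto simp: completions_def)
  then show ?thesis by (auto simp: card_eq_0_iff)
qed

section \<open>The value of the game\<close>

text \<open>The current flattening determines all earlier ones, so a strategy decides alike on all
  completions of \<open>t\<close>.\<close>

lemma history_completions:
  assumes "p \<in> completions N t" and "length t = i"
  shows "history p i = history t i"
proof -
  have "flatten (take l p) = flatten (take l t)" if "l \<le> i" for l
    using flatten_take_flatten[of l "take i p"] assms that by (simp add: completions_def min_def)
  then show ?thesis by (auto simp: history_def prefix_flattening_def)
qed

lemma accepted_rec:
  assumes "k < N"
  shows "accepted N k \<sigma> p
    = (if Suc k = N \<or> \<sigma> (history p (Suc k)) then Suc k else accepted N (Suc k) \<sigma> p)"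
proof (cases "Suc k = N \<or> \<sigma> (history p (Suc k))")
  case True
  then show ?thesis
    unfolding accepted_def by (auto intro!: Least_equality)
next
  case False
  then have "(k < i \<and> (i = N \<or> \<sigma> (history p i))) \<longleftrightarrow> (Suc k < i \<and> (i = N \<or> \<sigma> (history p i)))" for i
    by (cases "i = Suc k") auto
  then show ?thesis
    using False by (simp add: accepted_def)
qed

definition win_count :: "nat \<Rightarrow> strategy \<Rightarrow> nat list \<Rightarrow> nat" where
  "win_count N \<sigma> t = card {p \<in> completions N t. p ! (accepted N (length t) \<sigma> p - 1) = N}"

text \<open>The decision on candidate \<open>Suc i\<close> is constant on each branch. Accepting
  wins something only if the candidate is the current maximum, \<open>v = Suc i\<close>.\<close>

lemma win_count_rec:
  assumes "t \<in> Av321 i" and "i < N"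
  shows "win_count N \<sigma> t = (\<Sum>v = Suc (max_bottom t)..Suc i.
    if Suc i = N \<or> \<sigma> (history (ext t v) (Suc i))
    then if v = Suc i then wins (N - Suc i) (Suc i - max_bottom t) else 0
    else win_count N \<sigma> (ext t v))"
proof -
  note len = Av321_length[OF assms(1)]
  have "card {p \<in> completions N (ext t v). p ! (accepted N i \<sigma> p - 1) = N} =
      (if Suc i = N \<or> \<sigma> (history (ext t v) (Suc i))
       then if v = Suc i then wins (N - Suc i) (Suc i - max_bottom t) else 0
       else win_count N \<sigma> (ext t v))" (is "?L = _")
    if v: "v \<in> {Suc (max_bottom t)..Suc i}" for v
  proof -
    have av: "ext t v \<in> Av321 (Suc i)"
      using ext_in_Av321_iff[OF assms(1), of v] v by simp
    have last: "ext t v ! i = v" using ext_last(1)[of t v] len by simp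
    have hist: "history p (Suc i) = history (ext t v) (Suc i)"
      if "p \<in> completions N (ext t v)" for p
      using history_completions[OF that, of "Suc i"] len by simp
    show ?thesis
    proof (cases "Suc i = N \<or> \<sigma> (history (ext t v) (Suc i))")
      case True
      then have "?L = card {p \<in> completions N (ext t v). p ! i = N}"
        using hist by (intro arg_cong[of _ _ card]) (auto simp: accepted_rec[OF assms(2)])
      also have "\<dots> = (if v = Suc i then wins (N - Suc i) (Suc i - max_bottom t) else 0)"
        using card_completions_max[OF av, of N i] card_completions_not_max[OF av, of N i]
          assms(2) last max_bottom_ext[OF assms(1) v] by (cases "v = Suc i") simp_all
      finally show ?thesis using True by simp
    next
      case False
      then have "?L = win_count N \<sigma> (ext t v)"
        unfolding win_count_def using hist
        by (intro arg_cong[of _ _ card]) (auto simp: accepted_rec[OF assms(2)] len)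
      then show ?thesis using False by simp
    qed
  qed
  then show ?thesis
    using card_completions_split[OF assms] by (simp add: win_count_def len)
qed

text \<open>Puts the recursion, via \<open>q = Suc i - v\<close>, into a form that can be compared
  with \<open>win_count_rec\<close> term by term.\<close>

lemma val_Suc_reindex:
  assumes "m \<le> i"
  shows "val (Suc r) (i - m) = (\<Sum>v = Suc m..Suc i.
    if v = Suc i then max (wins r (Suc i - m)) (val r (Suc i - m)) else val r (Suc i - v))"
proof -
  have "(\<Sum>v = Suc m..i. if v = Suc i then max (wins r (Suc i - m)) (val r (Suc i - m))
      else val r (Suc i - v)) = (\<Sum>v = Suc m..i. val r (Suc i - v))"
    by (intro sum.cong) auto
  also have "\<dots> = (\<Sum>q = 1..i - m. val r q)"
    by (rule sum.reindex_bij_witness[of _ "\<lambda>q. Suc i - q" "\<lambda>v. Suc i - v"]) (use assms in auto)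
  finally show ?thesis
    using assms by (simp add: Suc_diff_le)
qed

lemma win_count_le:
  assumes "t \<in> Av321 i" and "i < N"
  shows "win_count N \<sigma> t \<le> val (N - i) (i - max_bottom t)"
  using assms
proof (induction "N - i" arbitrary: t i)
  case (Suc r)
  have r: "r = N - Suc i" using Suc.hyps(2) by simp
  have IH: "win_count N \<sigma> (ext t v) \<le>
      val r (Suc i - (if v = Suc i then max_bottom t else v))"
    if "v \<in> {Suc (max_bottom t)..Suc i}" "Suc i \<noteq> N" for v
    using Suc.hyps(1)[OF r, of "ext t v"] ext_in_Av321_iff[OF Suc.prems(1), of v]
      max_bottom_ext[OF Suc.prems(1), of v] that Suc.prems(2) r
    by (auto simp: le_Suc_eq split: if_splits)
  show ?case
    unfolding win_count_rec[OF Suc.prems] Suc.hyps(2)[symmetric]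
      val_Suc_reindex[OF max_bottom_le[OF Suc.prems(1)]] r[symmetric]
  proof (rule sum_mono)
    fix v assume v: "v \<in> {Suc (max_bottom t)..Suc i}"
    show "(if Suc i = N \<or> \<sigma> (history (ext t v) (Suc i))
        then if v = Suc i then wins r (Suc i - max_bottom t) else 0 else win_count N \<sigma> (ext t v))
      \<le> (if v = Suc i then max (wins r (Suc i - max_bottom t)) (val r (Suc i - max_bottom t))
         else val r (Suc i - v))"
      using IH[OF v] by (auto intro: max.coboundedI2)
  qed
qed simp

text \<open>Reads the state off the latest flattening and accepts a current maximum when this wins
  at least as many completions as the best play after rejecting it.\<close>

definition best_strategy :: "nat \<Rightarrow> strategy" where
  "best_strategy N h = (let t = last h; i = length t; j = i - max_bottom t in
     last t = i \<and> val (N - i) j \<le> wins (N - i) j)"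

lemma win_count_best:
  assumes "t \<in> Av321 i" and "i < N"
  shows "win_count N (best_strategy N) t = val (N - i) (i - max_bottom t)"
  using assms
proof (induction "N - i" arbitrary: t i)
  case (Suc r)
  have r: "r = N - Suc i" using Suc.hyps(2) by simp
  note len = Av321_length[OF Suc.prems(1)]
  show ?case
    unfolding win_count_rec[OF Suc.prems] Suc.hyps(2)[symmetric]
      val_Suc_reindex[OF max_bottom_le[OF Suc.prems(1)]] r[symmetric]
  proof (rule sum.cong[OF refl])
    fix v assume v: "v \<in> {Suc (max_bottom t)..Suc i}"
    have av: "ext t v \<in> Av321 (Suc i)"
      using ext_in_Av321_iff[OF Suc.prems(1), of v] v by simp
    then have "flatten (ext t v) = ext t v"
      by (rule Av321_flatten)
    then have "last (history (ext t v) (Suc i)) = ext t v"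
      using len by (simp add: history_def prefix_flattening_def)
    then have best: "best_strategy N (history (ext t v) (Suc i)) \<longleftrightarrow>
        v = Suc i \<and> val r (Suc i - max_bottom t) \<le> wins r (Suc i - max_bottom t)"
      using max_bottom_ext[OF Suc.prems(1) v] r len by (auto simp: best_strategy_def Let_def)
    have IH: "win_count N (best_strategy N) (ext t v) =
        val r (Suc i - (if v = Suc i then max_bottom t else v))" if "Suc i \<noteq> N"
      using Suc.hyps(1)[OF r av] max_bottom_ext[OF Suc.prems(1) v] that Suc.prems(2) r v
      by (simp split: if_splits)
    show "(if Suc i = N \<or> best_strategy N (history (ext t v) (Suc i))
        then if v = Suc i then wins r (Suc i - max_bottom t) else 0
        else win_count N (best_strategy N) (ext t v))
      = (if v = Suc i then max (wins r (Suc i - max_bottom t)) (val r (Suc i - max_bottom t))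
         else val r (Suc i - v))"
      \<comment> \<open>For \<open>Suc i = N\<close> we have \<open>r = 0\<close>, and
        \<open>val 0\<close> vanishes, so forced acceptance agrees with the right-hand side.\<close>
      using IH r unfolding best by (auto simp: max_def)
  qed
qed simp

section \<open>The identity prefix and optimality\<close>

lemma Av321_id_eq_completions: "Av321_id N k = completions N [1..<k + 1]"
  by (simp add: Av321_id_def completions_def prefix_flattening_def del: upt_Suc)

lemma identity_in_Av321: "[1..<k + 1] \<in> Av321 k"
  by (auto simp: Av321_def permutations_of_set_def contains_321_def simp del: upt_Suc)

lemma max_bottom_identity: "max_bottom [1..<k + 1] = 0"
proof -
  have "inv_bottoms [1..<k + 1] = {}"
    by (auto simp: inv_bottoms_def simp del: upt_Suc)
  then show ?thesis by (simp add: max_bottom_def)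
qed

text \<open>The identity has no inversion, so the state is \<open>(N - k, k)\<close>. Both
  probabilities share the denominator \<open>card (Av321_id N k)\<close>, and the maximum is
  attained by \<open>best_strategy N\<close>.\<close>

lemma optimal_iff:
  assumes "1 \<le> k" and "k < N"
  shows "optimal N k \<longleftrightarrow> val (N - k) k < wins (N - k) k"
proof -
  let ?t = "[1..<k + 1]"
  let ?A = "Av321_id N k"
  have A: "finite ?A" "?A \<noteq> {}"
    using Av321_id_finite_nonempty assms(2) by simp_all
  then have pos: "0 < real (card ?A)" by (simp add: card_gt_0_iff)
  have "card (?A \<inter> {p. p ! (k - 1) = N}) = card {p \<in> completions N ?t. p ! (k - 1) = N}"
    unfolding Av321_id_eq_completions by (simp add: Int_def del: upt_Suc)
  also have "\<dots> = wins (N - k) k"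
    using card_completions_max[OF identity_in_Av321, of k N "k - 1"] assms
    unfolding max_bottom_identity by (simp del: upt_Suc)
  finally have S: "S_prob N k = wins (N - k) k / card ?A"
    using A by (simp add: S_prob_def measure_pmf_of_set)
  have win: "win_prob N k \<sigma> = win_count N \<sigma> ?t / card ?A" for \<sigma>
    using A unfolding Av321_id_eq_completions
    by (simp add: win_prob_def win_count_def measure_pmf_of_set Av321_id_eq_completions Int_def
        del: upt_Suc)
  have "Bc_prob N k = val (N - k) k / card ?A"
    unfolding Bc_prob_def
  proof (rule Max_eqI)
    show "finite (range (win_prob N k))"
      using finite_range_win_prob assms(2) by simp
    show "x \<le> val (N - k) k / card ?A" if "x \<in> range (win_prob N k)" for x
      using that win_count_le[OF identity_in_Av321 assms(2), unfolded max_bottom_identity]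
      by (auto simp: win divide_right_mono simp del: upt_Suc)
    show "val (N - k) k / card ?A \<in> range (win_prob N k)"
      using win_count_best[OF identity_in_Av321 assms(2), unfolded max_bottom_identity]
      by (intro range_eqI[of _ _ "best_strategy N"]) (simp add: win del: upt_Suc)
  qed
  then show ?thesis
    using pos by (simp add: optimal_def S divide_less_cancel)
qed

theorem theorem4p5:
  fixes N k :: nat
  assumes "1 \<le> k" and "k + 1 \<le> N"
  shows "(optimal N k \<longrightarrow> optimal (N + 1) (k + 1)) \<and>
         (\<not> optimal N k \<longrightarrow> \<not> optimal (N + 1) k)"
proof -
  \<comment> \<open>Passing to \<open>(N + 1, k + 1)\<close> raises \<open>j\<close> and keeps
    \<open>r\<close>; passing to \<open>(N + 1, k)\<close> raises \<open>r\<close> and keeps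
    \<open>j\<close>.\<close>
  have "optimal N k \<longleftrightarrow> ratio (N - k) k < 1"
    "optimal (N + 1) (k + 1) \<longleftrightarrow> ratio (N - k) (Suc k) < 1"
    "optimal (N + 1) k \<longleftrightarrow> ratio (Suc (N - k)) k < 1"
    using assms by (simp_all add: optimal_iff val_less_wins_iff Suc_diff_le del: val.simps)
  then show ?thesis
    using ratio_antimono_Suc[OF assms(1), of "N - k"] ratio_Suc_ge[OF assms(1), of "N - k"]
    by linarith
qed

end
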